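(* Let $$D(x,y)=\sum_{\pi\in\mathcal{F}}x^{|\pi|}y^{\mathrm{trun}(\pi)-1}p^{\#123(\pi)}q^{\#231(\pi)}r^{\#221(\pi)}$$ be the generating function that enumerates the members of $\mathcal{F}$ jointly according to length, $\mathrm{trun}-1$, $\#123$, $\#231$ and $\#221$ (marked by $x$, $y$, $p$, $q$ and $r$, respectively). Then \begin{align*} D(x,y)&=\frac{x}{1-x(1+py)+(p-1)x^2y}\\ &\quad+\frac{x^2+(pq-p+r-1)x^3-(p-1)(q-1)x^4-xy(p-1)\left(1-(p+1)x+(p-1)x^2\right)^2}{(1-(p-1)x)\left(1-(p+1)x+(p-1)x^2\right)\left(1-x(1+py)+(p-1)x^2y\right)}\,V, \end{align*} where $$V=D(x,1)=\frac{x(1-(p-1)x)\left(1-(p+1)x+(p-1)x^2\right)}{1-2(p+1)x+(p^2+4p-2)x^2-(2p^2+pq-p+r-3)x^3+(p-1)(p+q-2)x^4}.$$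
   Context: A Catalan word of length $n\geq 1$ is an integer sequence $\pi=\pi_1\cdots\pi_n$ with $\pi_1=1$ and $1\leq \pi_{i+1}\leq \pi_i+1$ for $1\leq i\leq n-1$. A (weakly) increasing run of a word is a maximal nondecreasing string of consecutive letters. A Catalan word is flattened if the sequence of first letters of its increasing runs, read from left to right, is nondecreasing. $\mathcal{F}_n$ is the set of flattened Catalan words of length $n$, $\mathcal{F}=\cup_{n\geq 1}\mathcal{F}_n$, and $|\pi|$ is the length of $\pi$. For a word $w$, $\mathrm{trun}(w)$ is the number of distinct letters appearing in the rightmost increasing run of $w$. For a pattern $\tau=\tau_1\cdots\tau_m$, $\#\tau(\pi)$ is the number of occurrences of $\tau$ in $\pi$ as a consecutive (subword) pattern, i.e., the number of indices $i$ such that $\pi_i\pi_{i+1}\cdots\pi_{i+m-1}$ is order-isomorphic to $\tau$. Here $x,y,p,q,r$ are indeterminates and generating functions are formal power series in $x$ with coefficients polynomial in $y,p,q,r$. *)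

theory Defs
  imports
    "HOL-Computational_Algebra.Formal_Power_Series"
    "HOL-Computational_Algebra.Polynomial_Factorial"
begin

text \<open>Words are lists of natural numbers; positions are counted from 0.\<close>

definition catalan_word :: "nat list \<Rightarrow> bool" where
  "catalan_word w \<longleftrightarrow> w \<noteq> [] \<and> w ! 0 = 1 \<and>
     (\<forall>i. Suc i < length w \<longrightarrow> 1 \<le> w ! Suc i \<and> w ! Suc i \<le> w ! i + 1)"

fun inc_runs :: "nat list \<Rightarrow> nat list list" where
  "inc_runs [] = []"
| "inc_runs [a] = [[a]]"
| "inc_runs (a # b # w) =
     (if a \<le> b then (a # hd (inc_runs (b # w))) # tl (inc_runs (b # w))
      else [a] # inc_runs (b # w))"

lemma inc_runs_neq_Nil: "inc_runs (a # w) \<noteq> []"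
  by (cases w) auto

lemma hd_inc_runs: "hd (inc_runs (a # w)) \<noteq> [] \<and> hd (hd (inc_runs (a # w))) = a"
  by (cases w) auto

text \<open>The list \<^term>\<open>inc_runs w\<close> is the factorization of \<^term>\<open>w\<close> into nonempty
  nondecreasing factors none of which can be extended, as there is a descent
  between any two neighbours.\<close>

lemma concat_inc_runs: "concat (inc_runs w) = w"
proof (induction w rule: inc_runs.induct)
  case (3 a b w)
  obtain u us where "inc_runs (b # w) = u # us"
    using inc_runs_neq_Nil[of b w] by (cases "inc_runs (b # w)") auto
  with 3 show ?case by auto
qed auto

lemma inc_runs_sorted: "u \<in> set (inc_runs w) \<Longrightarrow> u \<noteq> [] \<and> sorted u"
proof (induction w arbitrary: u rule: inc_runs.induct)
  case (3 a b w)
  obtain v vs where v: "inc_runs (b # w) = v # vs"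
    using inc_runs_neq_Nil[of b w] by (cases "inc_runs (b # w)") auto
  obtain v' where v': "v = b # v'"
    using hd_inc_runs[of b w] v by (cases v) auto
  have "sorted v"
    using "3.IH" v by (cases "a \<le> b") auto
  then have "sorted (a # v)" if "a \<le> b"
    using that v' le_trans[OF that] by auto
  then show ?case
    using 3 v by (cases "a \<le> b") auto
qed auto

lemma inc_runs_descent: "successively (\<lambda>u v. last u > hd v) (inc_runs w)"
proof (induction w rule: inc_runs.induct)
  case (3 a b w)
  obtain v vs where v: "inc_runs (b # w) = v # vs"
    using inc_runs_neq_Nil[of b w] by (cases "inc_runs (b # w)") auto
  obtain v' where v': "v = b # v'"
    using hd_inc_runs[of b w] v by (cases v) auto
  show ?case
    using 3 v v' by (cases vs) auto
qed auto

definition flattened :: "nat list \<Rightarrow> bool" where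
  "flattened w \<longleftrightarrow> sorted (map hd (inc_runs w))"

definition flattened_catalan_words :: "nat \<Rightarrow> nat list set" where
  "flattened_catalan_words n = {w. catalan_word w \<and> flattened w \<and> length w = n}"

definition trun :: "nat list \<Rightarrow> nat" where
  "trun w = card (set (last (inc_runs w)))"

definition order_isomorphic :: "nat list \<Rightarrow> nat list \<Rightarrow> bool" where
  "order_isomorphic u v \<longleftrightarrow> length u = length v \<and>
     (\<forall>i < length u. \<forall>j < length u. u ! i < u ! j \<longleftrightarrow> v ! i < v ! j)"

definition occurrences :: "nat list \<Rightarrow> nat list \<Rightarrow> nat" where
  "occurrences t w =
     card {i. i + length t \<le> length w \<and> order_isomorphic (take (length t) (drop i w)) t}"

text \<open>The generating function as a power series in the length variable. The remaining
  weights are arguments, so that the series at \<open>y = 1\<close> is \<^term>\<open>flat_gf 1 p q r\<close>.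
  The constant coefficient is 0, since Catalan words are nonempty.\<close>

definition flat_gf :: "'a \<Rightarrow> 'a \<Rightarrow> 'a \<Rightarrow> 'a \<Rightarrow> 'a::comm_ring_1 fps" where
  "flat_gf y p q r = Abs_fps (\<lambda>n. \<Sum>w\<in>flattened_catalan_words n.
     y ^ (trun w - 1) * p ^ occurrences [1,2,3] w *
     q ^ occurrences [2,3,1] w * r ^ occurrences [2,2,1] w)"

text \<open>The four indeterminates of the iterated polynomial ring
  $Z[r][q][p][y]$, taken in its field of fractions; over a field the
  division of power series by a series with nonzero constant term is the usual one.\<close>

type_synonym weight = "int poly poly poly poly fract"

definition y_ind :: weight where "y_ind = to_fract [:0, 1:]"
definition p_ind :: weight where "p_ind = to_fract [:[:0, 1:]:]"
definition q_ind :: weight where "q_ind = to_fract [:[:[:0, 1:]:]:]"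
definition r_ind :: weight where "r_ind = to_fract [:[:[:[:0, 1:]:]:]:]"

end

theory Submission
  imports Defs
begin

text \<open>
  A flattened Catalan word \<open>w\<close> grows on the right. Let \<open>h\<close> be the first letter of its last
  increasing run and \<open>l\<close> its last letter. The letters that can be appended are exactly
  \<open>h, \<dots>, l + 1\<close> (\<open>snoc_in_FC_iff\<close>): the Catalan condition bounds the new letter by \<open>l + 1\<close>, and a
  new letter below \<open>l\<close> starts a new run, which flattening requires not to start below \<open>h\<close>.
  Inside a run a Catalan word climbs by steps of 0 or 1, so the last run contains
  every value from \<open>h\<close> to \<open>l\<close> and \<open>trun w - 1\<close> is the height \<open>l - h\<close> (\<open>trun_eq_height\<close>).

  The three patterns have length 3, so their new occurrences depend on the appended letter and on
  the last step of \<open>w\<close> only. That step is a rise by 1, a repetition, or neither; in the last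
  case the last run is a single letter and has height 0 (\<open>base_fresh\<close>). A rise creates a
  \<open>123\<close> exactly after a rise. After a repetition each of the \<open>l - h\<close> descents creates a \<open>221\<close>.
  After a rise each descent creates a \<open>231\<close>, with one exception: the descent to \<open>l - 1\<close> produces
  \<open>232\<close>. Hence the height and the last step of a word determine how its weight changes
  and which heights and last steps come next, and the generating functions \<open>N, L, U\<close> of the words
  whose last step is fresh, a repetition, a rise satisfy
  \<open>L = x (N + L + U)\<close> and \<open>U = x y (N + L + p U)\<close>, while \<open>N\<close> is free of \<open>y\<close> and equals
  \<open>x + x (r L' + q U' + (1 - q) U)\<close> at \<open>y = 1\<close>, where the prime is the derivative in \<open>y\<close>; it
  arises because the number of descents is the height.

  The first two equations express \<open>D = N + L + U\<close> and \<open>U\<close> as multiples of \<open>N\<close>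
  (\<open>flat_gf_fresh\<close>). The derivatives at 1 satisfy linear equations of the same kind, which turn
  the third equation into a single one for \<open>N\<close> (\<open>gf_fresh_equation\<close>). Comparing \<open>D\<close> at general
  \<open>y\<close> with \<open>V\<close>, its value at \<open>y = 1\<close>, eliminates \<open>N\<close> and gives both closed forms.
\<close>

section \<open>Appending a letter\<close>

lemma inc_runs_eq_Nil_iff [simp]: "inc_runs w = [] \<longleftrightarrow> w = []"
  using inc_runs_neq_Nil by (cases w) auto

lemma inc_runs_snoc:
  assumes "w \<noteq> []"
  shows "inc_runs (w @ [c]) =
    (if last w \<le> c then butlast (inc_runs w) @ [last (inc_runs w) @ [c]]
     else inc_runs w @ [[c]])"
  using assms
proof (induction w rule: inc_runs.induct)
  case (3 a b w)
  obtain u us where u: "inc_runs (b # w) = u # us"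
    using inc_runs_neq_Nil[of b w] by (cases "inc_runs (b # w)") auto
  show ?case
    using 3 u by (cases us) auto
qed auto

definition base :: "nat list \<Rightarrow> nat" where
  "base w = hd (last (inc_runs w))"

definition height :: "nat list \<Rightarrow> nat" where
  "height w = last w - base w"

lemma last_inc_runs_neq_Nil: "w \<noteq> [] \<Longrightarrow> last (inc_runs w) \<noteq> []"
  using inc_runs_sorted[of "last (inc_runs w)" w] by simp

lemma base_singleton [simp]: "base [a] = a"
  by (simp add: base_def)

lemma base_snoc: "w \<noteq> [] \<Longrightarrow> base (w @ [c]) = (if last w \<le> c then base w else c)"
  using last_inc_runs_neq_Nil[of w] by (simp add: base_def inc_runs_snoc)

lemma base_le_last: "w \<noteq> [] \<Longrightarrow> base w \<le> last w"
proof (induction w rule: rev_induct)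
  case (snoc c w)
  then show ?case by (cases "w = []") (auto simp: base_snoc)
qed simp

lemma base_in_set: "w \<noteq> [] \<Longrightarrow> base w \<in> set w"
proof (induction w rule: rev_induct)
  case (snoc c w)
  then show ?case by (cases "w = []") (auto simp: base_snoc)
qed simp

lemma catalan_word_snoc:
  assumes "w \<noteq> []"
  shows "catalan_word (w @ [c]) \<longleftrightarrow> catalan_word w \<and> 1 \<le> c \<and> c \<le> Suc (last w)"
proof -
  obtain n where n: "length w = Suc n"
    using assms by (cases w) auto
  have "last w = w ! n"
    using assms n by (simp add: last_conv_nth)
  then show ?thesis
    using assms n unfolding catalan_word_def
    by (auto simp: nth_append less_Suc_eq all_conj_distrib imp_conjL)
qed

lemma catalan_word_singleton: "catalan_word [a] \<longleftrightarrow> a = 1"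
  by (auto simp: catalan_word_def)

text \<open>Positivity of the first letter of the last run makes the lower bound 1 in the Catalan
  condition follow from the flattening condition.\<close>

lemma catalan_word_letter_ge_1: "catalan_word w \<Longrightarrow> a \<in> set w \<Longrightarrow> 1 \<le> a"
proof (induction w arbitrary: a rule: rev_induct)
  case (snoc c w)
  then show ?case
    by (cases "w = []") (auto simp: catalan_word_snoc catalan_word_singleton)
qed simp

text \<open>A letter that extends the last run leaves the list of first letters unchanged, and it is at
  least the first letter of that run. A letter below the last one becomes the new last entry of
  that list.\<close>

lemma flattened_snoc:
  assumes "w \<noteq> []"
  shows "flattened (w @ [c]) \<longleftrightarrow> flattened w \<and> base w \<le> c"
proof -
  obtain us u where us: "inc_runs w = us @ [u]"
    using assms by (metis inc_runs_eq_Nil_iff rev_exhaust)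
  have u: "u \<noteq> []" "base w = hd u"
    using last_inc_runs_neq_Nil[OF assms] by (auto simp: base_def us)
  have w: "flattened w \<longleftrightarrow> sorted (map hd us @ [hd u])"
    by (simp add: flattened_def us)
  show ?thesis
  proof (cases "last w \<le> c")
    case True
    then have "flattened (w @ [c]) \<longleftrightarrow> flattened w"
      using assms u by (simp add: flattened_def inc_runs_snoc us)
    with True base_le_last[OF assms] show ?thesis by simp
  next
    case False
    then have "flattened (w @ [c]) \<longleftrightarrow> sorted (map hd us @ [hd u, c])"
      using assms by (simp add: flattened_def inc_runs_snoc us)
    with u w show ?thesis
      by (auto simp: sorted_append)
  qed
qed

text \<open>A run cannot skip a value, since a Catalan word rises by at most 1 at a time.\<close>

lemma set_last_run_catalan:
  "catalan_word w \<Longrightarrow> set (last (inc_runs w)) = {base w..last w}"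
proof (induction w rule: rev_induct)
  case (snoc c w)
  show ?case
  proof (cases "w = []")
    case False
    with snoc have "set (last (inc_runs w)) = {base w..last w}" "c \<le> Suc (last w)"
      by (auto simp: catalan_word_snoc)
    with False base_le_last[OF False] show ?thesis
      by (auto simp: base_snoc inc_runs_snoc)
  qed simp
qed (simp add: catalan_word_def)

lemma trun_eq_height:
  assumes "catalan_word w"
  shows "trun w - 1 = height w"
  unfolding trun_def height_def set_last_run_catalan[OF assms] by simp

section \<open>The transfer step\<close>

abbreviation FC :: "nat \<Rightarrow> nat list set" where
  "FC \<equiv> flattened_catalan_words"

lemma FC_0: "FC 0 = {}"
  by (auto simp: flattened_catalan_words_def catalan_word_def)

lemma FC_1: "FC (Suc 0) = {[1]}"
  by (auto simp: flattened_catalan_words_def length_Suc_conv catalan_word_singleton flattened_def)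

lemma FC_neq_Nil: "w \<in> FC n \<Longrightarrow> w \<noteq> []"
  by (auto simp: flattened_catalan_words_def catalan_word_def)

lemma FC_catalan: "w \<in> FC n \<Longrightarrow> catalan_word w"
  by (auto simp: flattened_catalan_words_def)

lemma snoc_in_FC_iff:
  assumes "w \<noteq> []"
  shows "w @ [c] \<in> FC (Suc n) \<longleftrightarrow> w \<in> FC n \<and> c \<in> {base w..Suc (last w)}"
  using assms catalan_word_letter_ge_1[OF _ base_in_set[OF assms]]
  by (auto simp: flattened_catalan_words_def catalan_word_snoc flattened_snoc)

lemma FC_Suc:
  assumes "n > 0"
  shows "FC (Suc n) = (\<lambda>(w, c). w @ [c]) ` (SIGMA w:FC n. {base w..Suc (last w)})"
proof (intro equalityI subsetI)
  fix v assume v: "v \<in> FC (Suc n)"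
  then have len: "length v = Suc n"
    by (simp add: flattened_catalan_words_def)
  then obtain w c where w: "v = w @ [c]"
    by (metis length_Suc_conv_rev)
  with len assms have "w \<noteq> []" by auto
  with v w snoc_in_FC_iff[of w c n]
  show "v \<in> (\<lambda>(w, c). w @ [c]) ` (SIGMA w:FC n. {base w..Suc (last w)})"
    by (auto intro!: image_eqI[where x = "(w, c)"])
qed (use snoc_in_FC_iff FC_neq_Nil in auto)

lemma finite_FC: "finite (FC n)"
proof (induction n)
  case (Suc n)
  then show ?case
    by (cases "n = 0") (auto simp: FC_1 FC_Suc)
qed (simp add: FC_0)

text \<open>The appended letters are grouped by the last step that they create: a descent,
  a repetition, or a rise.\<close>

lemma sum_FC_Suc:
  fixes g :: "nat list \<Rightarrow> 'b::comm_monoid_add"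
  assumes "n > 0"
  shows "sum g (FC (Suc n)) = (\<Sum>w\<in>FC n.
    (\<Sum>c\<in>{base w..<last w}. g (w @ [c])) + g (w @ [last w]) + g (w @ [Suc (last w)]))"
proof -
  have "sum g (FC (Suc n)) =
      (\<Sum>(w, c)\<in>(SIGMA w:FC n. {base w..Suc (last w)}). g (w @ [c]))"
    unfolding FC_Suc[OF assms]
    by (subst sum.reindex) (auto simp: inj_on_def case_prod_unfold)
  also have "\<dots> = (\<Sum>w\<in>FC n. \<Sum>c\<in>{base w..Suc (last w)}. g (w @ [c]))"
    by (rule sum.Sigma[symmetric]) (auto simp: finite_FC)
  also have "\<dots> = (\<Sum>w\<in>FC n.
    (\<Sum>c\<in>{base w..<last w}. g (w @ [c])) + g (w @ [last w]) + g (w @ [Suc (last w)]))"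
  proof (rule sum.cong)
    fix w assume "w \<in> FC n"
    then have "base w \<le> last w"
      by (intro base_le_last FC_neq_Nil)
    then show "(\<Sum>c\<in>{base w..Suc (last w)}. g (w @ [c])) =
      (\<Sum>c\<in>{base w..<last w}. g (w @ [c])) + g (w @ [last w]) + g (w @ [Suc (last w)])"
      by (simp flip: atLeastLessThanSuc_atLeastAtMost)
  qed simp
  finally show ?thesis .
qed

section \<open>The last step of a word\<close>

definition rises :: "nat list \<Rightarrow> bool" where
  "rises w \<longleftrightarrow> butlast w \<noteq> [] \<and> last (butlast w) < last w"

definition repeats :: "nat list \<Rightarrow> bool" where
  "repeats w \<longleftrightarrow> butlast w \<noteq> [] \<and> last (butlast w) = last w"

text \<open>For a nonempty word these are the cases in which the last letter starts a run:
  the word is a single letter or ends with a descent.\<close>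

definition fresh :: "nat list \<Rightarrow> bool" where
  "fresh w \<longleftrightarrow> \<not> rises w \<and> \<not> repeats w"

lemma last_step_snoc:
  "w \<noteq> [] \<Longrightarrow> rises (w @ [c]) \<longleftrightarrow> last w < c"
  "w \<noteq> [] \<Longrightarrow> repeats (w @ [c]) \<longleftrightarrow> last w = c"
  "w \<noteq> [] \<Longrightarrow> fresh (w @ [c]) \<longleftrightarrow> c < last w"
  by (auto simp: rises_def repeats_def fresh_def)

lemma last_step_singleton: "\<not> rises [a]" "\<not> repeats [a]" "fresh [a]"
  by (auto simp: rises_def repeats_def fresh_def)

lemma not_rises_and_repeats: "rises w \<Longrightarrow> \<not> repeats w"
  by (simp add: rises_def repeats_def)

lemma base_fresh: "w \<noteq> [] \<Longrightarrow> fresh w \<Longrightarrow> base w = last w"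
proof (induction w rule: rev_induct)
  case (snoc c w)
  then show ?case by (cases "w = []") (auto simp: base_snoc last_step_snoc)
qed simp

text \<open>The second fact makes the height positive after a rise, so that at least one descent
  is possible.\<close>

lemma catalan_rises:
  assumes "catalan_word w" "rises w"
  shows "last w = Suc (last (butlast w))" and "base w < last w"
proof -
  have "w \<noteq> []" and ne: "butlast w \<noteq> []"
    using assms by (auto simp: rises_def)
  then have w: "w = butlast w @ [last w]" by simp
  have "catalan_word (butlast w @ [last w])"
    using assms w by simp
  then show "last w = Suc (last (butlast w))"
    using assms(2) catalan_word_snoc[OF ne, of "last w"] by (simp add: rises_def)
  have "base w = base (butlast w)"
    using base_snoc[OF ne, of "last w"] w assms(2) by (simp add: rises_def)
  then show "base w < last w"
    using base_le_last[OF ne] assms(2) by (simp add: rises_def)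
qed

lemma height_snoc:
  assumes "w \<noteq> []"
  shows "height (w @ [last w]) = height w"
    and "height (w @ [Suc (last w)]) = Suc (height w)"
    and "c < last w \<Longrightarrow> height (w @ [c]) = 0"
  using assms base_le_last[OF assms] by (auto simp: height_def base_snoc)

section \<open>The weight of a word\<close>

text \<open>Only the window formed by the last three letters is new; it exists if the old word has at
  least two letters, that is, if \<open>butlast w\<close> is nonempty.\<close>

lemma occurrences_snoc:
  assumes "length t = 3"
  shows "occurrences t (w @ [c]) = occurrences t w +
    (if butlast w \<noteq> [] \<and> order_isomorphic [last (butlast w), last w, c] t then 1 else 0)"
proof -
  let ?occ = "\<lambda>w. {i. i + length t \<le> length w \<and> order_isomorphic (take (length t) (drop i w)) t}"
  have fin: "finite (?occ w)"
    by (rule finite_subset[of _ "{..length w}"]) auto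
  show ?thesis
  proof (cases "butlast w = []")
    case True
    then have "length w \<le> 1"
      by (cases w) (auto split: if_splits)
    with True assms show ?thesis
      by (simp add: occurrences_def)
  next
    case False
    obtain v a b where w: "w = v @ [a, b]"
      using False by (metis append.assoc append_Cons append_Nil append_butlast_last_id butlast.simps(1))
    have "?occ (w @ [c]) = ?occ w \<union> (if order_isomorphic [a, b, c] t then {length v} else {})"
    proof (rule set_eqI)
      fix i
      consider "i + 3 \<le> length w" | "i = length v" | "i > length v"
        by (fastforce simp: w)
      then show "i \<in> ?occ (w @ [c]) \<longleftrightarrow>
          i \<in> ?occ w \<union> (if order_isomorphic [a, b, c] t then {length v} else {})"
      proof cases
        case 1
        then have "take 3 (drop i (w @ [c])) = take 3 (drop i w)" by simp
        with 1 assms show ?thesis by (auto simp: w)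
      qed (use assms in \<open>auto simp: w\<close>)
    qed
    moreover have "length v \<notin> ?occ w"
      using assms by (simp add: w)
    ultimately show ?thesis
      using fin by (simp add: occurrences_def w butlast_append)
  qed
qed

lemma occurrences_singleton: "length t = 3 \<Longrightarrow> occurrences t [a] = 0"
  by (simp add: occurrences_def)

text \<open>The patterns are written with \<open>Suc 0\<close>, the form to which the simplifier brings the
  letter 1.\<close>

lemma order_isomorphic_123: "order_isomorphic [a, b, c] [Suc 0, 2, 3] \<longleftrightarrow> a < b \<and> b < c"
  by (auto simp: order_isomorphic_def All_less_Suc)

lemma order_isomorphic_231: "order_isomorphic [a, b, c] [2, 3, Suc 0] \<longleftrightarrow> c < a \<and> a < b"
  by (auto simp: order_isomorphic_def All_less_Suc)

lemma order_isomorphic_221: "order_isomorphic [a, b, c] [2, 2, Suc 0] \<longleftrightarrow> a = b \<and> c < a"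
  by (auto simp: order_isomorphic_def All_less_Suc)

context
  fixes p q r :: "'a::comm_ring_1"
begin

definition word_weight :: "nat list \<Rightarrow> 'a" where
  "word_weight w = p ^ occurrences [1,2,3] w * q ^ occurrences [2,3,1] w * r ^ occurrences [2,2,1] w"

lemma word_weight_singleton: "word_weight [a] = 1"
  by (simp add: word_weight_def occurrences_singleton)

lemma word_weight_snoc_last: "word_weight (w @ [last w]) = word_weight w"
  by (auto simp: word_weight_def occurrences_snoc order_isomorphic_123 order_isomorphic_231
      order_isomorphic_221)

lemma word_weight_snoc_rise:
  "word_weight (w @ [Suc (last w)]) = (if rises w then p else 1) * word_weight w"
  by (auto simp: word_weight_def occurrences_snoc order_isomorphic_123 order_isomorphic_231
      order_isomorphic_221 rises_def)

lemma word_weight_snoc_descent: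
  assumes "c < last w"
  shows "word_weight (w @ [c]) =
    (if repeats w then r else if rises w \<and> c < last (butlast w) then q else 1) * word_weight w"
  using assms
  by (auto simp: word_weight_def occurrences_snoc order_isomorphic_123 order_isomorphic_231
      order_isomorphic_221 rises_def repeats_def mult_ac)

text \<open>Of the \<open>height w\<close> descents that are possible after a rise, the one to the letter before
  the rise creates the word pattern \<open>232\<close> and costs no \<open>q\<close>. This gives
  \<open>q (height w - 1) + 1\<close>, written with \<open>1 - q\<close> so that no subtraction of natural numbers
  appears.\<close>

lemma sum_word_weight_descents:
  assumes "catalan_word w"
  shows "(\<Sum>c\<in>{base w..<last w}. word_weight (w @ [c])) =
    (if repeats w then r * of_nat (height w) * word_weight w
     else if rises w then (q * of_nat (height w) + (1 - q)) * word_weight w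
     else 0)"
proof -
  have ne: "w \<noteq> []" using assms by (auto simp: catalan_word_def)
  consider (repeats) "repeats w" | (rises) "rises w" "\<not> repeats w" | (fresh) "fresh w"
    by (auto simp: fresh_def)
  then show ?thesis
  proof cases
    case repeats
    then show ?thesis
      by (simp add: word_weight_snoc_descent height_def mult_ac)
  next
    case rises
    define b where "b = last (butlast w)"
    have b: "last w = Suc b" "base w \<le> b"
      using catalan_rises[OF assms rises(1)] by (auto simp: b_def)
    have "(\<Sum>c\<in>{base w..<last w}. word_weight (w @ [c])) =
        (\<Sum>c\<in>{base w..<b}. word_weight (w @ [c])) + word_weight (w @ [b])"
      using b by simp
    also have "\<dots> = of_nat (b - base w) * (q * word_weight w) + word_weight w"
      using rises b by (simp add: word_weight_snoc_descent b_def)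
    also have "\<dots> = (q * of_nat (height w) + (1 - q)) * word_weight w"
      using b by (simp add: height_def Suc_diff_le algebra_simps)
    finally show ?thesis
      using rises by simp
  next
    case fresh
    then show ?thesis
      using base_fresh[OF ne fresh] by (simp add: fresh_def)
  qed
qed

section \<open>A linear system\<close>

text \<open>A word of height \<open>j\<close> is weighted by \<open>f j\<close> for an arbitrary function \<open>f\<close>. The choice
  \<open>f j = y ^ j\<close> gives the generating function in \<open>y\<close>, and \<open>f = of_nat\<close> gives its derivative
  at \<open>y = 1\<close>, so that both obey the same recurrences.\<close>

definition gf_by_height :: "(nat list \<Rightarrow> bool) \<Rightarrow> (nat \<Rightarrow> 'a) \<Rightarrow> 'a fps" where
  "gf_by_height P f = Abs_fps (\<lambda>n. \<Sum>w\<in>FC n. if P w then f (height w) * word_weight w else 0)"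

lemma gf_by_height_add:
  "gf_by_height P (\<lambda>j. f j + g j) = gf_by_height P f + gf_by_height P g"
  by (auto simp: gf_by_height_def fps_eq_iff ring_distribs intro!: sum.cong simp flip: sum.distrib)

lemma gf_by_height_cmult:
  "gf_by_height P (\<lambda>j. a * f j) = fps_const a * gf_by_height P f"
  by (auto simp: gf_by_height_def fps_eq_iff sum_distrib_left mult.assoc intro!: sum.cong)

lemma gf_by_height_split:
  "gf_by_height (\<lambda>_. True) f =
     gf_by_height fresh f + gf_by_height repeats f + gf_by_height rises f"
  using not_rises_and_repeats
  by (auto simp: gf_by_height_def fps_eq_iff fresh_def intro!: sum.cong simp flip: sum.distrib)

lemma flat_gf_eq: "flat_gf y p q r = gf_by_height (\<lambda>_. True) (\<lambda>j. y ^ j)"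
  by (auto simp: flat_gf_def gf_by_height_def fps_eq_iff word_weight_def mult.assoc
      trun_eq_height[OF FC_catalan, simplified] intro!: sum.cong)

lemma gf_repeats:
  "gf_by_height repeats f = fps_X * gf_by_height (\<lambda>_. True) f"
proof (rule fps_ext)
  fix n
  consider "n = 0" | "n = 1" | m where "n = Suc m" "m > 0"
    by (metis One_nat_def gr0I not0_implies_Suc)
  then show "fps_nth (gf_by_height repeats f) n = fps_nth (fps_X * gf_by_height (\<lambda>_. True) f) n"
    by cases (auto simp: gf_by_height_def FC_0 FC_1 last_step_singleton sum_FC_Suc
        last_step_snoc FC_neq_Nil word_weight_snoc_last height_snoc intro!: sum.cong)
qed

text \<open>A rise increases the height by 1, so \<open>f\<close> is shifted; it completes a \<open>123\<close>
  exactly if the step before is also a rise.\<close>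

lemma gf_rises:
  "gf_by_height rises f = fps_X * (gf_by_height fresh (\<lambda>j. f (Suc j))
     + gf_by_height repeats (\<lambda>j. f (Suc j)) + fps_const p * gf_by_height rises (\<lambda>j. f (Suc j)))"
proof (rule fps_ext)
  fix n
  consider "n = 0" | "n = 1" | m where "n = Suc m" "m > 0"
    by (metis One_nat_def gr0I not0_implies_Suc)
  then show "fps_nth (gf_by_height rises f) n = fps_nth (fps_X * (gf_by_height fresh (\<lambda>j. f (Suc j))
     + gf_by_height repeats (\<lambda>j. f (Suc j)) + fps_const p * gf_by_height rises (\<lambda>j. f (Suc j)))) n"
  proof cases
    case (3 m)
    have "fps_nth (gf_by_height rises f) n = (\<Sum>w\<in>FC m. f (Suc (height w)) * word_weight (w @ [Suc (last w)]))"
      using 3 by (auto simp: gf_by_height_def sum_FC_Suc last_step_snoc FC_neq_Nil height_snoc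
          intro!: sum.cong)
    also have "\<dots> = (\<Sum>w\<in>FC m. (if fresh w then f (Suc (height w)) * word_weight w else 0)
        + (if repeats w then f (Suc (height w)) * word_weight w else 0)
        + p * (if rises w then f (Suc (height w)) * word_weight w else 0))"
      using not_rises_and_repeats
      by (intro sum.cong) (auto simp: word_weight_snoc_rise fresh_def mult_ac)
    finally show ?thesis
      using 3 by (simp add: gf_by_height_def sum.distrib sum_distrib_left)
  qed (auto simp: gf_by_height_def FC_0 FC_1 last_step_singleton)
qed

text \<open>Fresh words are the one-letter word, which accounts for the summand 1, and those that end
  with a descent. They have height 0, so \<open>f\<close> enters through \<open>f 0\<close> only.\<close>

lemma gf_fresh:
  "gf_by_height fresh f = fps_const (f 0) * fps_X * (1 + fps_const r * gf_by_height repeats of_nat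
     + fps_const q * gf_by_height rises of_nat + fps_const (1 - q) * gf_by_height rises (\<lambda>_. 1))"
proof (rule fps_ext)
  fix n
  consider "n = 0" | "n = 1" | m where "n = Suc m" "m > 0"
    by (metis One_nat_def gr0I not0_implies_Suc)
  then show "fps_nth (gf_by_height fresh f) n = fps_nth (fps_const (f 0) * fps_X *
     (1 + fps_const r * gf_by_height repeats of_nat
      + fps_const q * gf_by_height rises of_nat + fps_const (1 - q) * gf_by_height rises (\<lambda>_. 1))) n"
  proof cases
    case (3 m)
    have "fps_nth (gf_by_height fresh f) n =
        (\<Sum>w\<in>FC m. \<Sum>c\<in>{base w..<last w}. f 0 * word_weight (w @ [c]))"
      using 3 by (auto simp: gf_by_height_def sum_FC_Suc last_step_snoc FC_neq_Nil height_snoc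
          intro!: sum.cong)
    also have "\<dots> = (\<Sum>w\<in>FC m. f 0 * (r * (if repeats w then of_nat (height w) * word_weight w else 0)
        + q * (if rises w then of_nat (height w) * word_weight w else 0)
        + (1 - q) * (if rises w then 1 * word_weight w else 0)))"
      using not_rises_and_repeats
      by (intro sum.cong)
         (auto simp: sum_word_weight_descents FC_catalan algebra_simps simp flip: sum_distrib_left)
    finally show ?thesis
      using 3 by (simp add: gf_by_height_def sum.distrib sum_distrib_left mult.assoc ring_distribs)
  qed (auto simp: gf_by_height_def FC_0 FC_1 last_step_singleton height_def word_weight_singleton
      mult.assoc)
qed

lemma gf_by_height_fresh_of_nat: "gf_by_height fresh of_nat = 0"
  by (simp add: gf_fresh)

text \<open>Elimination of the words ending with a repetition from the two equations for repetitions
  and rises. The common factor is the determinant of that system,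
  \<open>(1 - x) (1 - p x y) - x\<^sup>2 y\<close>.\<close>

lemma flat_gf_fresh:
  fixes y :: 'a
  defines "Y \<equiv> fps_const y" and "P \<equiv> fps_const p" and "N \<equiv> gf_by_height fresh (\<lambda>_. 1)"
  shows "(1 - fps_X * (1 + P * Y) + (P - 1) * fps_X^2 * Y) * flat_gf y p q r
           = N * (1 - fps_X * Y * (P - 1))"
    and "(1 - fps_X * (1 + P * Y) + (P - 1) * fps_X^2 * Y) * gf_by_height rises (\<lambda>j. y ^ j)
           = fps_X * Y * N"
proof -
  define D where "D = flat_gf y p q r"
  define L where "L = gf_by_height repeats (\<lambda>j. y ^ j)"
  define U where "U = gf_by_height rises (\<lambda>j. y ^ j)"
  have N: "gf_by_height fresh (\<lambda>j. y ^ j) = N"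
    using gf_fresh[of "\<lambda>j. y ^ j"] gf_fresh[of "\<lambda>_. 1"] by (simp add: N_def)
  have D: "D = N + L + U"
    using gf_by_height_split[of "\<lambda>j. y ^ j"] by (simp add: D_def flat_gf_eq L_def U_def N)
  have L: "L = fps_X * D"
    unfolding L_def D_def flat_gf_eq by (rule gf_repeats)
  have "U = fps_X * (Y * N + Y * L + P * (Y * U))"
    using gf_rises[of "\<lambda>j. y ^ j"]
    by (simp add: gf_by_height_cmult N flip: U_def L_def Y_def P_def)
  \<comment> \<open>Together with \<open>U = (1 - x) D - N\<close>, this is an equation between \<open>D\<close> and \<open>N\<close> alone.\<close>
  then have "U - fps_X * (Y * N + Y * L + P * (Y * U)) = 0" by simp
  moreover have U: "U = (1 - fps_X) * D - N"
    using D L by (simp add: algebra_simps)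
  ultimately have "((1 - fps_X) * D - N) -
      fps_X * (Y * N + Y * (fps_X * D) + P * (Y * ((1 - fps_X) * D - N))) = 0"
    using L by simp
  then show *: "(1 - fps_X * (1 + P * Y) + (P - 1) * fps_X^2 * Y) * flat_gf y p q r
           = N * (1 - fps_X * Y * (P - 1))"
    unfolding D_def[symmetric] by (simp add: algebra_simps power2_eq_square)
  have "(1 - fps_X * (1 + P * Y) + (P - 1) * fps_X^2 * Y) * U =
    (1 - fps_X) * ((1 - fps_X * (1 + P * Y) + (P - 1) * fps_X^2 * Y) * D)
     - (1 - fps_X * (1 + P * Y) + (P - 1) * fps_X^2 * Y) * N"
    unfolding U by (simp add: algebra_simps)
  also have "\<dots> = fps_X * Y * N"
    unfolding *[folded D_def] by (simp add: algebra_simps power2_eq_square)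
  finally show "(1 - fps_X * (1 + P * Y) + (P - 1) * fps_X^2 * Y) * gf_by_height rises (\<lambda>j. y ^ j)
           = fps_X * Y * N"
    by (simp add: U_def)
qed

text \<open>In the equation for fresh words all unknowns other than \<open>N\<close> are multiples of \<open>N\<close>:
  with \<open>B\<close> the determinant at \<open>y = 1\<close>, the rises satisfy \<open>B U = x N\<close>, and the derivatives
  \<open>M\<close> of the repetitions and \<open>K\<close> of the rises satisfy \<open>B M = x U\<close> and \<open>B K = (1 - x) U\<close>.
  Multiplication by \<open>B\<^sup>2\<close> therefore clears all denominators.\<close>

lemma gf_fresh_equation:
  defines "P \<equiv> fps_const p" and "Q \<equiv> fps_const q" and "R \<equiv> fps_const r"
    and "N \<equiv> gf_by_height fresh (\<lambda>_. 1)"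
  defines "B \<equiv> 1 - (P + 1) * fps_X + (P - 1) * fps_X^2"
  shows "(B^2 - fps_X^2 - (P * Q - P + R - 1) * fps_X^3 + (P - 1) * (Q - 1) * fps_X^4) * N
           = fps_X * B^2"
proof -
  define L where "L = gf_by_height repeats (\<lambda>_. 1)"
  define U where "U = gf_by_height rises (\<lambda>_. 1)"
  define M where "M = gf_by_height repeats of_nat"
  define K where "K = gf_by_height rises of_nat"
  have N: "N = fps_X * (1 + R * M + Q * K + (1 - Q) * U)"
    using gf_fresh[of "\<lambda>_. 1"]
    by (simp add: M_def K_def U_def N_def R_def Q_def flip: fps_const_sub)
  have BU: "B * U = fps_X * N"
    using flat_gf_fresh(2)[of 1] by (simp add: B_def U_def N_def P_def algebra_simps)
  have U: "U = fps_X * (N + L + P * U)"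
    using gf_rises[of "\<lambda>_. 1"] by (simp add: U_def L_def N_def P_def)
  have "M = fps_X * (M + K)"
    using gf_repeats[of of_nat] gf_by_height_split[of of_nat]
    by (simp add: M_def K_def gf_by_height_fresh_of_nat)
  then have M: "M - fps_X * (M + K) = 0"
    by (simp only: right_minus_eq)
  have "K = fps_X * (N + (L + M) + P * (U + K))"
    using gf_rises[of of_nat]
    by (simp add: gf_by_height_add gf_by_height_fresh_of_nat
        flip: M_def K_def U_def L_def N_def P_def)
  then have "K = fps_X * (N + L + P * U) + fps_X * (M + P * K)"
    by (simp add: algebra_simps)
  then have "K = U + fps_X * (M + P * K)"
    by (simp flip: U)
  then have K: "K - fps_X * (M + P * K) = U"
    by (simp only: diff_eq_eq)
  \<comment> \<open>Cramer's rule for the system \<open>K - x (M + p K) = U\<close>, \<open>M - x (M + K) = 0\<close>, whose determinant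
    is \<open>B\<close>.\<close>
  have "B * K = (1 - fps_X) * (K - fps_X * (M + P * K)) + fps_X * (M - fps_X * (M + K))"
    by (simp add: B_def algebra_simps power2_eq_square)
  also have "\<dots> = (1 - fps_X) * U"
    unfolding K M by simp
  finally have BK: "B * K = (1 - fps_X) * U" .
  have "B * M = (1 - P * fps_X) * (M - fps_X * (M + K)) + fps_X * (K - fps_X * (M + P * K))"
    by (simp add: B_def algebra_simps power2_eq_square)
  also have "\<dots> = fps_X * U"
    unfolding K M by simp
  finally have BM: "B * M = fps_X * U" .
  have "B^2 * N = B * (fps_X * (B + R * (B * M) + Q * (B * K) + (1 - Q) * (B * U)))"
    by (subst (1) N) (simp add: algebra_simps power2_eq_square)
  also have "\<dots> = fps_X * B^2 +
      fps_X * (R * fps_X + Q * (1 - fps_X) + (1 - Q) * B) * (B * U)"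
    unfolding BM BK by (simp add: algebra_simps power2_eq_square)
  also have "\<dots> = fps_X * B^2 + fps_X^2 * (R * fps_X + Q * (1 - fps_X) + (1 - Q) * B) * N"
    unfolding BU by (simp add: algebra_simps power2_eq_square)
  also have "fps_X^2 * (R * fps_X + Q * (1 - fps_X) + (1 - Q) * B) =
      fps_X^2 + (P * Q - P + R - 1) * fps_X^3 - (P - 1) * (Q - 1) * fps_X^4"
    by (simp add: B_def algebra_simps power2_eq_square power3_eq_cube power4_eq_xxxx)
  finally show ?thesis
    by (simp add: algebra_simps)
qed

end

section \<open>Solving the system\<close>

lemma fps_divide_mult_cancel:
  fixes f g :: "'a::field fps"
  assumes "fps_nth g 0 \<noteq> 0"
  shows "f / g * g = f"
  using assms by (simp add: fps_divide_unit mult.assoc inverse_mult_eq_1)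

context
  fixes y p q r :: "'a::field" and x Y P Q R A B C W V D :: "'a fps"
  defines "x \<equiv> fps_X" and "Y \<equiv> fps_const y" and "P \<equiv> fps_const p" and "Q \<equiv> fps_const q"
    and "R \<equiv> fps_const r"
  defines "A \<equiv> 1 - x * (1 + P * Y) + (P - 1) * x^2 * Y"
    and "B \<equiv> 1 - (P + 1) * x + (P - 1) * x^2"
    and "C \<equiv> 1 - (P - 1) * x"
    and "W \<equiv> x^2 + (P * Q - P + R - 1) * x^3 - (P - 1) * (Q - 1) * x^4"
    and "V \<equiv> flat_gf 1 p q r" and "D \<equiv> flat_gf y p q r"
begin

text \<open>All denominators have constant coefficient 1, so they are units in the ring of power series
  and can be cancelled.\<close>

lemma const_coeffs:
  "fps_nth A 0 = 1" "fps_nth B 0 = 1" "fps_nth C 0 = 1" "fps_nth (B^2 - W) 0 = 1"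
  by (simp_all add: A_def B_def C_def W_def x_def fps_power_zeroth)

lemma nonzero: "A \<noteq> 0" "B \<noteq> 0" "C \<noteq> 0"
  using const_coeffs by auto

text \<open>At \<open>y = 1\<close> the factor \<open>A\<close> becomes \<open>B\<close> and \<open>1 - x y (p - 1)\<close> becomes \<open>C\<close>. Thus \<open>V\<close>
  determines the fresh words, which then determine \<open>D\<close>.\<close>

lemma flat_gf_1_via_fresh: "B * V = C * gf_by_height p q r fresh (\<lambda>_. 1)"
  using flat_gf_fresh(1)[where y = 1 and p = p and q = q and r = r]
  by (simp add: B_def V_def C_def x_def P_def algebra_simps)

lemma flat_gf_1_equation: "(B^2 - W) * V = x * B * C"
proof -
  define N where "N = gf_by_height p q r fresh (\<lambda>_. 1)"
  have N: "(B^2 - W) * N = x * B^2"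
    using gf_fresh_equation[of p q r]
    by (simp add: N_def W_def B_def P_def Q_def R_def x_def algebra_simps)
  have "B * ((B^2 - W) * V) = (B^2 - W) * (B * V)"
    by (simp only: mult_ac)
  also have "\<dots> = C * ((B^2 - W) * N)"
    unfolding flat_gf_1_via_fresh N_def by (simp only: mult_ac)
  also have "\<dots> = B * (x * B * C)"
    unfolding N by (simp only: power2_eq_square mult_ac)
  finally show ?thesis
    using nonzero by simp
qed

lemma flat_gf_equation: "C * A * D = B * V * (1 - x * Y * (P - 1))"
  using flat_gf_fresh(1)[where y = y and p = p and q = q and r = r] flat_gf_1_via_fresh
  by (simp add: A_def D_def x_def P_def Y_def mult_ac)

lemma flat_gf_1_closed_form: "V = x * C * B / (B^2 - W)"
proof -
  have "V * (B^2 - W) = x * C * B / (B^2 - W) * (B^2 - W)"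
    using flat_gf_1_equation const_coeffs(4)
    by (subst fps_divide_mult_cancel) (simp_all only: mult_ac one_neq_zero not_False_eq_True)
  moreover have "B^2 - W \<noteq> 0"
    using const_coeffs(4) by (metis fps_zero_nth zero_neq_one)
  ultimately show ?thesis
    by (simp only: mult_cancel_right simp_thms)
qed

text \<open>The claimed sum is a rewriting of \<open>C A D = B V (1 - x y (p - 1))\<close>: after multiplication
  by \<open>B\<close> the right-hand side is \<open>B\<^sup>2 V - x y (p - 1) B\<^sup>2 V\<close>, and the equation for \<open>V\<close> replaces
  its first term by \<open>x B C + W V\<close>.\<close>

lemma flat_gf_closed_form:
  "D = x / A + (W - x * Y * (P - 1) * B^2) / (C * B * A) * V"
proof -
  let ?n = "W - x * Y * (P - 1) * B^2"
  have nz: "fps_nth A 0 \<noteq> 0" "fps_nth (C * B * A) 0 \<noteq> 0"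
    by (simp_all add: const_coeffs)
  have "(C * B * A) * D = B * (C * A * D)"
    by (simp only: mult_ac)
  also have "\<dots> = x * B * C + ?n * V"
    unfolding flat_gf_equation flat_gf_1_equation[symmetric]
    by (simp add: algebra_simps power2_eq_square)
  also have "\<dots> = (C * B) * (x / A * A) + (?n / (C * B * A) * (C * B * A)) * V"
    unfolding fps_divide_mult_cancel[OF nz(1)] fps_divide_mult_cancel[OF nz(2)]
    by (simp only: mult_ac)
  also have "\<dots> = (C * B * A) * (x / A + ?n / (C * B * A) * V)"
    by (simp only: algebra_simps)
  finally show ?thesis
    using nonzero by simp
qed

lemma denominator_expanded:
  "B^2 - W = 1 - 2 * (P + 1) * x + (P^2 + 4 * P - 2) * x^2
     - (2 * P^2 + P * Q - P + R - 3) * x^3 + (P - 1) * (P + Q - 2) * x^4"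
  by (simp add: B_def W_def algebra_simps power2_eq_square power3_eq_cube power4_eq_xxxx)

end

theorem theorem3p2:
  shows "let x = (fps_X :: weight fps);
             y = fps_const y_ind; p = fps_const p_ind; q = fps_const q_ind; r = fps_const r_ind;
             D = flat_gf y_ind p_ind q_ind r_ind;
             V = flat_gf 1 p_ind q_ind r_ind
         in D = x / (1 - x * (1 + p * y) + (p - 1) * x^2 * y)
              + (x^2 + (p * q - p + r - 1) * x^3 - (p - 1) * (q - 1) * x^4
                   - x * y * (p - 1) * (1 - (p + 1) * x + (p - 1) * x^2)^2)
                / ((1 - (p - 1) * x) * (1 - (p + 1) * x + (p - 1) * x^2)
                     * (1 - x * (1 + p * y) + (p - 1) * x^2 * y))
                * V
          \<and> V = x * (1 - (p - 1) * x) * (1 - (p + 1) * x + (p - 1) * x^2)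
                / (1 - 2 * (p + 1) * x + (p^2 + 4 * p - 2) * x^2
                     - (2 * p^2 + p * q - p + r - 3) * x^3
                     + (p - 1) * (p + q - 2) * x^4)"
  unfolding Let_def
  by (intro conjI flat_gf_closed_form flat_gf_1_closed_form[unfolded denominator_expanded])

end
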